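(* Let $G$ be a group of type $\mathrm{B}_n$ with $n\geq 2$. Let $\chi$ be an irreducible character of $G$ of non-zero $p$-defect. Then $\chi$ is $p$-constant for some prime $p\leq n$ if and only if $p>2$, $C_2^n\leq\ker(\chi)$ and the corresponding character $\bar\chi$ of $\mathrm{Sym}(n)$ is $p$-constant.
   Context: The finite reflection group of type $\mathrm{B}_n$ is isomorphic to the wreath product $C_2\wr\mathrm{Sym}(n)=C_2^n\rtimes\mathrm{Sym}(n)$, where $C_2$ is the cyclic group of order $2$ and the symmetric group $\mathrm{Sym}(n)$ of degree $n$ permutes the $n$ factors of $C_2^n$. Characters are complex. When $C_2^n\leq\ker(\chi)$, $\bar\chi$ is the irreducible character of $G/C_2^n\cong\mathrm{Sym}(n)$ whose inflation to $G$ is $\chi$. For a finite group $X$ and a prime $p$ dividing $|X|$, the $p$-singular elements of $X$ are those whose order is divisible by $p$; an irreducible character of $X$ is $p$-constant if it takes one constant value on all $p$-singular elements of $X$. An irreducible character $\chi$ of $X$ has $p$-defect zero if the order of a Sylow $p$-subgroup of $X$ divides $\chi(1)$ (equivalently, if $\chi$ is $p$-constant with constant value $0$), and non-zero $p$-defect otherwise.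
   Formalization: For p = 2 the trivial character is excluded: it is 2-constant of non-zero 2-defect, so the claim as stated (which requires p > 2) fails for it; p is read as one fixed prime ≤ n throughout. *)

theory Defs
  imports
    "HOL-Algebra.Algebra"
    "Jordan_Normal_Form.VS_Connect"
begin

section \<open>Complex irreducible characters\<close>

abbreviation GL :: "nat \<Rightarrow> complex mat monoid" where
  "GL d \<equiv> units_of (ring_mat TYPE(complex) d ())"

definition irreducible_rep :: "('a, 'b) monoid_scheme \<Rightarrow> nat \<Rightarrow> ('a \<Rightarrow> complex mat) \<Rightarrow> bool" where
  "irreducible_rep G d \<rho> \<longleftrightarrow>
     \<rho> \<in> hom G (GL d) \<and> d > 0 \<and>
     (\<forall>W. VectorSpace.subspace class_ring W (module_vec TYPE(complex) d) \<and>
          (\<forall>g\<in>carrier G. \<forall>w\<in>W. \<rho> g *\<^sub>v w \<in> W) \<longrightarrow>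
          W = {0\<^sub>v d} \<or> W = carrier_vec d)"

definition mat_trace :: "complex mat \<Rightarrow> complex" where
  "mat_trace A = (\<Sum>i<dim_row A. A $$ (i, i))"

text \<open>Characters are restricted to the carrier, so that they are determined by their
  values on the group.\<close>

definition Irr :: "('a, 'b) monoid_scheme \<Rightarrow> ('a \<Rightarrow> complex) set" where
  "Irr G = {\<chi>. \<exists>d \<rho>. irreducible_rep G d \<rho> \<and> \<chi> = (\<lambda>g\<in>carrier G. mat_trace (\<rho> g))}"

text \<open>The trivial character is constant on the 2-singular elements and, for even group order,
  not of 2-defect zero.\<close>

definition trivial_char :: "('a, 'b) monoid_scheme \<Rightarrow> 'a \<Rightarrow> complex" where
  "trivial_char G = (\<lambda>g\<in>carrier G. 1)"

definition char_kernel :: "('a, 'b) monoid_scheme \<Rightarrow> ('a \<Rightarrow> complex) \<Rightarrow> 'a set" where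
  "char_kernel G \<chi> = {g \<in> carrier G. \<chi> g = \<chi> \<one>\<^bsub>G\<^esub>}"


section \<open>Defect zero and p-constancy\<close>

definition p_singular :: "nat \<Rightarrow> ('a, 'b) monoid_scheme \<Rightarrow> 'a set" where
  "p_singular p G = {g \<in> carrier G. p dvd group.ord G g}"

definition p_constant :: "nat \<Rightarrow> ('a, 'b) monoid_scheme \<Rightarrow> ('a \<Rightarrow> complex) \<Rightarrow> bool" where
  "p_constant p G \<chi> \<longleftrightarrow> (\<exists>c. \<forall>g\<in>p_singular p G. \<chi> g = c)"

definition sylow_subgroup :: "nat \<Rightarrow> ('a, 'b) monoid_scheme \<Rightarrow> 'a set \<Rightarrow> bool" where
  "sylow_subgroup p G P \<longleftrightarrow> subgroup P G \<and> card P = p ^ multiplicity p (Coset.order G)"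

definition defect_zero :: "nat \<Rightarrow> ('a, 'b) monoid_scheme \<Rightarrow> ('a \<Rightarrow> complex) \<Rightarrow> bool" where
  "defect_zero p G \<chi> \<longleftrightarrow>
     (\<exists>P k. sylow_subgroup p G P \<and> \<chi> \<one>\<^bsub>G\<^esub> = of_nat (card P * k))"


section \<open>The group of type B\<close>

definition C2_power :: "nat \<Rightarrow> (nat \<Rightarrow> int) monoid" where
  "C2_power n = product_group {1..n} (\<lambda>_. integer_mod_group 2)"

text \<open>A permutation \<open>\<sigma>\<close> moves the \<open>i\<close>-th factor of the base group to the \<open>\<sigma> i\<close>-th one.
  Here \<open>inv_into UNIV \<sigma>\<close> is the inverse permutation.\<close>

definition permute_factors :: "nat \<Rightarrow> (nat \<Rightarrow> nat) \<Rightarrow> (nat \<Rightarrow> int) \<Rightarrow> nat \<Rightarrow> int" where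
  "permute_factors n \<sigma> f = (\<lambda>i\<in>{1..n}. f (inv_into UNIV \<sigma> i))"

definition wreath_C2_Sym :: "nat \<Rightarrow> ((nat \<Rightarrow> int) \<times> (nat \<Rightarrow> nat)) monoid" where
  "wreath_C2_Sym n =
     \<lparr>carrier = carrier (C2_power n) \<times> carrier (sym_group n),
      monoid.mult = (\<lambda>(f, \<sigma>) (g, \<tau>).
        (f \<otimes>\<^bsub>C2_power n\<^esub> permute_factors n \<sigma> g, \<sigma> \<otimes>\<^bsub>sym_group n\<^esub> \<tau>)),
      one = (\<one>\<^bsub>C2_power n\<^esub>, \<one>\<^bsub>sym_group n\<^esub>)\<rparr>"

definition base_subgroup :: "nat \<Rightarrow> ((nat \<Rightarrow> int) \<times> (nat \<Rightarrow> nat)) set" where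
  "base_subgroup n = carrier (C2_power n) \<times> {\<one>\<^bsub>sym_group n\<^esub>}"

text \<open>For an isomorphism \<open>\<phi>\<close> from the wreath product to \<open>G\<close>, the quotient of \<open>G\<close> by the image
  of the base group is identified with the symmetric group through the second projection. The
  description is meaningful when the image of the base group lies in the kernel of \<open>\<chi>\<close>.\<close>

definition bar_char ::
  "nat \<Rightarrow> ((nat \<Rightarrow> int) \<times> (nat \<Rightarrow> nat) \<Rightarrow> 'a) \<Rightarrow> ('a \<Rightarrow> complex) \<Rightarrow> (nat \<Rightarrow> nat) \<Rightarrow> complex" where
  "bar_char n \<phi> \<chi> =
     (THE \<psi>. \<psi> \<in> Irr (sym_group n) \<and> (\<forall>x\<in>carrier (wreath_C2_Sym n). \<chi> (\<phi> x) = \<psi> (snd x)))"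

lemma group_C2_power: "group (C2_power n)"
  by (simp add: C2_power_def)

lemma group_wreath_C2_Sym: "group (wreath_C2_Sym n)"
proof -
  interpret C: group "C2_power n" by (rule group_C2_power)
  interpret S: group "sym_group n" by (rule sym_group_is_group)
  note carr = sym_group_carrier
  have pin: "inv_into UNIV \<sigma> i \<in> {1..n}" if "\<sigma> permutes {1..n}" "i \<in> {1..n}" for \<sigma> i
    using that by (metis permutes_in_image permutes_inv)
  have cl: "permute_factors n \<sigma> f \<in> carrier (C2_power n)"
    if "f \<in> carrier (C2_power n)" "\<sigma> \<in> carrier (sym_group n)" for f \<sigma>
    using that pin
    by (auto simp: permute_factors_def C2_power_def carr PiE_iff extensional_def)
  have dist: "permute_factors n \<sigma> (f \<otimes>\<^bsub>C2_power n\<^esub> g) =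
      permute_factors n \<sigma> f \<otimes>\<^bsub>C2_power n\<^esub> permute_factors n \<sigma> g"
    if "\<sigma> \<in> carrier (sym_group n)" for \<sigma> f g
    using that pin
    by (intro ext) (auto simp: permute_factors_def C2_power_def carr restrict_def)
  have comp: "permute_factors n (\<sigma> \<otimes>\<^bsub>sym_group n\<^esub> \<tau>) f =
      permute_factors n \<sigma> (permute_factors n \<tau> f)"
    if "\<sigma> \<in> carrier (sym_group n)" "\<tau> \<in> carrier (sym_group n)" for \<sigma> \<tau> f
  proof -
    have "inv_into UNIV (\<sigma> \<circ> \<tau>) = inv_into UNIV \<tau> \<circ> inv_into UNIV \<sigma>"
      using that by (intro o_inv_distrib) (auto simp: carr permutes_bij)
    then show ?thesis
      using that pin[of \<sigma>]
      by (intro ext) (auto simp: permute_factors_def sym_group_mult carr)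
  qed
  have idt: "permute_factors n \<one>\<^bsub>sym_group n\<^esub> f = f" if "f \<in> carrier (C2_power n)" for f
    using that
    by (intro ext) (auto simp: permute_factors_def sym_group_one C2_power_def PiE_iff extensional_def)
  have one: "permute_factors n \<sigma> \<one>\<^bsub>C2_power n\<^esub> = \<one>\<^bsub>C2_power n\<^esub>"
    if "\<sigma> \<in> carrier (sym_group n)" for \<sigma>
    using that pin by (intro ext) (auto simp: permute_factors_def C2_power_def carr)
  show ?thesis
  proof (rule groupI, goal_cases)
    case (5 x)
    obtain f \<sigma> where x: "x = (f, \<sigma>)" "f \<in> carrier (C2_power n)" "\<sigma> \<in> carrier (sym_group n)"
      using 5 by (auto simp: wreath_C2_Sym_def)
    define \<tau> where "\<tau> = inv\<^bsub>sym_group n\<^esub> \<sigma>"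
    have \<tau>: "\<tau> \<in> carrier (sym_group n)" "\<tau> \<otimes>\<^bsub>sym_group n\<^esub> \<sigma> = \<one>\<^bsub>sym_group n\<^esub>"
      unfolding \<tau>_def using x S.inv_closed S.l_inv by blast+
    show ?case
      by (rule bexI[of _ "(inv\<^bsub>C2_power n\<^esub> permute_factors n \<tau> f, \<tau>)"])
        (use x \<tau> cl in \<open>auto simp: wreath_C2_Sym_def\<close>)
  qed (auto simp: wreath_C2_Sym_def cl dist comp idt one C.m_assoc S.m_assoc)
qed

end

theory Submission
  imports Defs "Jordan_Normal_Form.Schur_Decomposition"
begin

text \<open>
  Let \<open>\<rho>\<close> be a representation with character \<open>\<chi>\<close> of degree \<open>d\<close>, and suppose that \<open>\<chi>\<close> has the constant
  value \<open>c\<close> on the \<open>p\<close>-singular elements. The tool throughout is the average of \<open>\<rho>\<close> over a subgroup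
  \<open>H\<close>: it is an idempotent matrix, so its trace is a natural number, which vanishes only if the
  matrix does (\<open>idempotent_mat_trace\<close>).

  If \<open>c = 0\<close>, take for \<open>H\<close> a Sylow \<open>p\<close>-subgroup. All its elements but the identity are
  \<open>p\<close>-singular, so the average has trace \<open>d / card H\<close>, and \<open>\<chi>\<close> has defect zero
  (\<open>defect_zero_if_vanishes_on_p_singular\<close>).

  If \<open>c \<noteq> 0\<close>, take for \<open>H\<close> the base group \<open>N\<close>. For a permutation \<open>\<sigma>\<close> of order \<open>p\<close>, the whole coset
  of \<open>N\<close> above \<open>\<sigma>\<close> consists of \<open>p\<close>-singular elements, so the average over \<open>N\<close> times the matrix of \<open>\<sigma>\<close>
  has trace \<open>c\<close> and the average is not zero. Hence there are nonzero \<open>N\<close>-fixed vectors. They form an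
  invariant subspace since \<open>N\<close> is normal, so by irreducibility \<open>N\<close> acts trivially
  (\<open>normal_subgroup_acts_trivially\<close>, \<open>base_acts_trivially_if_p_constant\<close>), and \<open>\<chi>\<close> is inflated from
  the symmetric group. For \<open>p = 2\<close> more is true: the base group itself contains \<open>2\<close>-singular elements,
  so \<open>c = d\<close>, hence the transpositions act trivially as well and \<open>\<chi>\<close> is the trivial character
  (\<open>acts_trivially_if_2_constant\<close>, \<open>dim_eq_1_if_acts_trivially\<close>).

  What remains is a comparison of constancy on the wreath product and on the symmetric group for an
  inflated character. A lift of a \<open>p\<close>-singular permutation is \<open>p\<close>-singular; for odd \<open>p\<close> the converse
  holds, because the base group is a \<open>2\<close>-group (\<open>p_singular_snd_if_wreath\<close>).
\<close>


section \<open>Traces and idempotent matrices\<close>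

lemma index_mult_mat_sum:
  assumes "A \<in> carrier_mat m k" "B \<in> carrier_mat k l" "i < m" "j < l"
  shows "(A * B) $$ (i, j) = (\<Sum>r<k. A $$ (i, r) * B $$ (r, j))"
  using assms by (auto simp: scalar_prod_def atLeast0LessThan)

lemma mat_trace_mult_commute:
  assumes "A \<in> carrier_mat m k" "B \<in> carrier_mat k m"
  shows "mat_trace (A * B) = mat_trace (B * A)"
proof -
  have "mat_trace (A * B) = (\<Sum>i<m. \<Sum>j<k. A $$ (i, j) * B $$ (j, i))"
    using assms by (auto simp: mat_trace_def scalar_prod_def atLeast0LessThan intro!: sum.cong)
  also have "\<dots> = (\<Sum>j<k. \<Sum>i<m. B $$ (j, i) * A $$ (i, j))"
    by (subst sum.swap) (simp add: mult.commute)
  also have "\<dots> = mat_trace (B * A)"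
    using assms by (auto simp: mat_trace_def scalar_prod_def atLeast0LessThan intro!: sum.cong)
  finally show ?thesis .
qed

lemma mat_trace_one: "mat_trace (1\<^sub>m d) = of_nat d"
  by (simp add: mat_trace_def)

lemma mat_trace_minus:
  assumes "A \<in> carrier_mat d d" "B \<in> carrier_mat d d"
  shows "mat_trace (A - B) = mat_trace A - mat_trace B"
  using assms by (auto simp: mat_trace_def sum_subtractf)

text \<open>In \<open>B $$ (i, j) = (\<Sum>k. B $$ (i, k) * B $$ (k, j))\<close> only the indices strictly between
  \<open>i\<close> and \<open>j\<close> contribute, so the entries vanish one diagonal after the other.\<close>

lemma strictly_upper_triangular_idempotent_eq_0:
  fixes B :: "complex mat"
  assumes B: "B \<in> carrier_mat d d" "B * B = B"
    and tri: "\<And>i j. j \<le> i \<Longrightarrow> i < d \<Longrightarrow> B $$ (i, j) = 0"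
  shows "B = 0\<^sub>m d d"
proof -
  have "i < d \<longrightarrow> j < d \<longrightarrow> B $$ (i, j) = 0" for i j
  proof (induction "j - i" arbitrary: i j rule: less_induct)
    case less
    show ?case
    proof (intro impI)
      assume ij: "i < d" "j < d"
      have "B $$ (i, j) = (\<Sum>k<d. B $$ (i, k) * B $$ (k, j))"
        using index_mult_mat_sum[OF B(1) B(1) ij] by (simp add: B(2))
      also have "\<dots> = 0"
      proof (intro sum.neutral ballI)
        fix k assume "k \<in> {..<d}"
        then have k: "k < d" by simp
        consider "k \<le> i" | "j \<le> k" | "i < k" "k < j" by linarith
        then show "B $$ (i, k) * B $$ (k, j) = 0"
        proof cases
          case 3
          then have "j - k < j - i" by linarith
          from less[OF this] k ij show ?thesis by simp
        qed (use tri k ij in auto)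
      qed
      finally show "B $$ (i, j) = 0" .
    qed
  qed
  then show ?thesis using B by (intro eq_matI) auto
qed

text \<open>The trace of an idempotent is its rank. It is read off from a triangular form, whose
  diagonal entries are idempotent numbers, that is, 0 or 1; if all of them are 0, the triangular
  form is nilpotent as well as idempotent.\<close>

lemma idempotent_mat_trace:
  assumes A: "A \<in> carrier_mat d d" "A * A = A"
  obtains k where "mat_trace A = of_nat k" "k = 0 \<Longrightarrow> A = 0\<^sub>m d d"
proof -
  from char_poly_factorized[OF A(1)]
  obtain es where es: "char_poly A = (\<Prod>a\<leftarrow>es. [:- a, 1:])" by auto
  obtain B P Q where dec: "schur_decomposition A es = (B, P, Q)"
    by (cases "schur_decomposition A es")
  from schur_decomposition[OF A(1) es dec]
  have sim: "similar_mat_wit A B P Q" and ut: "upper_triangular B" by auto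
  from sim A(1) have c: "B \<in> carrier_mat d d" "P \<in> carrier_mat d d" "Q \<in> carrier_mat d d"
    and PQ: "P * Q = 1\<^sub>m d" "Q * P = 1\<^sub>m d" and AB: "A = P * B * Q"
    by (auto simp: similar_mat_wit_def Let_def)
  have BA: "B = Q * A * P"
  proof -
    have "Q * A * P = (Q * P) * B * (Q * P)"
      unfolding AB using c by (simp add: assoc_mult_mat[of _ d d _ d _ d])
    then show ?thesis using PQ c by simp
  qed
  have BB: "B * B = B"
  proof -
    have "B * B = Q * A * (P * Q) * A * P"
      unfolding BA using c A(1) by (simp add: assoc_mult_mat[of _ d d _ d _ d])
    also have "\<dots> = Q * (A * A) * P"
      using PQ c A(1) by (simp add: assoc_mult_mat[of _ d d _ d _ d])
    finally show ?thesis using A(2) BA by simp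
  qed
  have tr: "mat_trace A = mat_trace B"
  proof -
    have "mat_trace A = mat_trace (P * (B * Q))"
      unfolding AB using c by (simp add: assoc_mult_mat[of _ d d _ d _ d])
    also have "\<dots> = mat_trace (B * Q * P)"
      using c by (intro mat_trace_mult_commute[of _ d d]) auto
    also have "B * Q * P = B"
      using PQ c by (simp add: assoc_mult_mat[of _ d d _ d _ d])
    finally show ?thesis .
  qed
  have low: "B $$ (i, j) = 0" if "j < i" "i < d" for i j
    using ut that c by (auto simp: upper_triangular_def)
  have diag: "B $$ (i, i) \<in> {0, 1}" if i: "i < d" for i
  proof -
    have "B $$ (i, i) = (\<Sum>k<d. B $$ (i, k) * B $$ (k, i))"
      using index_mult_mat_sum[OF c(1) c(1) i i] by (simp add: BB)
    also have "\<dots> = (\<Sum>k\<in>{i}. B $$ (i, k) * B $$ (k, i))"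
    proof (intro sum.mono_neutral_right ballI)
      fix k assume "k \<in> {..<d} - {i}"
      then have "k < d" "k < i \<or> i < k" by auto
      then show "B $$ (i, k) * B $$ (k, i) = 0" using low i by auto
    qed (use i in auto)
    finally have "B $$ (i, i) * (B $$ (i, i) - 1) = 0" by (simp add: algebra_simps)
    then show ?thesis by simp
  qed
  define K where "K = {i. i < d \<and> B $$ (i, i) = 1}"
  have fK: "finite K" unfolding K_def by simp
  have "mat_trace A = (\<Sum>i<d. B $$ (i, i))"
    unfolding tr using c(1) by (simp add: mat_trace_def)
  also have "\<dots> = (\<Sum>i<d. if B $$ (i, i) = 1 then 1 else 0)"
    using diag by (intro sum.cong) auto
  also have "\<dots> = of_nat (card K)"
    unfolding K_def by (subst sum.If_cases) (auto simp: Int_def)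
  finally have "mat_trace A = of_nat (card K)" .
  moreover have "A = 0\<^sub>m d d" if "card K = 0"
  proof -
    from that fK have "K = {}" by simp
    then have "B $$ (i, i) = 0" if "i < d" for i
      using diag[OF that] that by (auto simp: K_def)
    with low have "B $$ (i, j) = 0" if "j \<le> i" "i < d" for i j
      using that by (cases "i = j") auto
    with c BB have "B = 0\<^sub>m d d" by (intro strictly_upper_triangular_idempotent_eq_0)
    then show ?thesis using AB c by simp
  qed
  ultimately show ?thesis by (rule that)
qed

lemma idempotent_mat_full_trace_eq_1:
  assumes A: "A \<in> carrier_mat d d" "A * A = A" and tr: "mat_trace A = of_nat d"
  shows "A = 1\<^sub>m d"
proof -
  let ?B = "1\<^sub>m d - A"
  have B: "?B \<in> carrier_mat d d" using A by auto
  have "?B * ?B = ?B"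
  proof -
    have "?B * ?B = 1\<^sub>m d * ?B - A * ?B"
      using A by (intro minus_mult_distrib_mat) auto
    also have "A * ?B = A * 1\<^sub>m d - A * A"
      using A by (intro mult_minus_distrib_mat) auto
    finally show ?thesis using A by (intro eq_matI) auto
  qed
  moreover have "mat_trace ?B = 0"
    using A tr by (subst mat_trace_minus[of _ d]) (auto simp: mat_trace_one)
  ultimately have z: "?B = 0\<^sub>m d d"
    using idempotent_mat_trace[OF B] by (metis of_nat_eq_0_iff)
  show ?thesis
  proof (rule eq_matI)
    fix i j assume "i < dim_row (1\<^sub>m d :: complex mat)" "j < dim_col (1\<^sub>m d :: complex mat)"
    moreover from this have "?B $$ (i, j) = 0" using z by simp
    ultimately show "A $$ (i, j) = 1\<^sub>m d $$ (i, j)" using A(1) by auto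
  qed (use A in auto)
qed


section \<open>Averages of matrices\<close>

definition mat_avg :: "nat \<Rightarrow> 'x set \<Rightarrow> ('x \<Rightarrow> complex mat) \<Rightarrow> complex mat" where
  "mat_avg d S M = mat d d (\<lambda>(i, j). (\<Sum>x\<in>S. M x $$ (i, j)) / of_nat (card S))"

lemma mat_avg_carrier [simp]: "mat_avg d S M \<in> carrier_mat d d"
  by (simp add: mat_avg_def)

lemma mat_avg_cong:
  assumes "\<And>x. x \<in> S \<Longrightarrow> M x = M' x"
  shows "mat_avg d S M = mat_avg d S M'"
  using assms by (simp add: mat_avg_def)

lemma mat_avg_const:
  assumes "finite S" "S \<noteq> {}" "A \<in> carrier_mat d d"
  shows "mat_avg d S (\<lambda>_. A) = A"
  using assms by (intro eq_matI) (auto simp: mat_avg_def)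

lemma mat_avg_reindex:
  assumes "bij_betw f S S"
  shows "mat_avg d S (\<lambda>x. M (f x)) = mat_avg d S M"
  using sum.reindex_bij_betw[OF assms, of "\<lambda>x. M x $$ _"] by (simp add: mat_avg_def)

lemma mat_avg_mult_right:
  assumes B: "B \<in> carrier_mat d d" and M: "\<And>x. x \<in> S \<Longrightarrow> M x \<in> carrier_mat d d"
  shows "mat_avg d S M * B = mat_avg d S (\<lambda>x. M x * B)"
proof (rule eq_matI)
  fix i j assume "i < dim_row (mat_avg d S (\<lambda>x. M x * B))" "j < dim_col (mat_avg d S (\<lambda>x. M x * B))"
  then have ij: "i < d" "j < d" by (auto simp: mat_avg_def)
  have "(mat_avg d S M * B) $$ (i, j) = (\<Sum>k<d. (\<Sum>x\<in>S. M x $$ (i, k)) / of_nat (card S) * B $$ (k, j))"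
    using ij B by (auto simp: mat_avg_def scalar_prod_def atLeast0LessThan)
  also have "\<dots> = (\<Sum>k<d. \<Sum>x\<in>S. M x $$ (i, k) * B $$ (k, j)) / of_nat (card S)"
    by (simp add: sum_distrib_right sum_divide_distrib)
  also have "\<dots> = (\<Sum>x\<in>S. \<Sum>k<d. M x $$ (i, k) * B $$ (k, j)) / of_nat (card S)"
    by (subst sum.swap) simp
  also have "(\<Sum>x\<in>S. \<Sum>k<d. M x $$ (i, k) * B $$ (k, j)) = (\<Sum>x\<in>S. (M x * B) $$ (i, j))"
  proof (rule sum.cong)
    fix x assume "x \<in> S"
    from M[OF this] show "(\<Sum>k<d. M x $$ (i, k) * B $$ (k, j)) = (M x * B) $$ (i, j)"
      using ij B by (simp only: index_mult_mat_sum[of _ d d _ d])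
  qed simp
  finally show "(mat_avg d S M * B) $$ (i, j) = mat_avg d S (\<lambda>x. M x * B) $$ (i, j)"
    using ij by (simp add: mat_avg_def)
qed (use B in \<open>auto simp: mat_avg_def\<close>)

lemma mat_avg_mult_left:
  assumes B: "B \<in> carrier_mat d d" and M: "\<And>x. x \<in> S \<Longrightarrow> M x \<in> carrier_mat d d"
  shows "B * mat_avg d S M = mat_avg d S (\<lambda>x. B * M x)"
proof (rule eq_matI)
  fix i j assume "i < dim_row (mat_avg d S (\<lambda>x. B * M x))" "j < dim_col (mat_avg d S (\<lambda>x. B * M x))"
  then have ij: "i < d" "j < d" by (auto simp: mat_avg_def)
  have "(B * mat_avg d S M) $$ (i, j) = (\<Sum>k<d. B $$ (i, k) * ((\<Sum>x\<in>S. M x $$ (k, j)) / of_nat (card S)))"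
    using ij B by (auto simp: mat_avg_def scalar_prod_def atLeast0LessThan)
  also have "\<dots> = (\<Sum>k<d. \<Sum>x\<in>S. B $$ (i, k) * M x $$ (k, j)) / of_nat (card S)"
    by (simp add: sum_distrib_left sum_divide_distrib)
  also have "\<dots> = (\<Sum>x\<in>S. \<Sum>k<d. B $$ (i, k) * M x $$ (k, j)) / of_nat (card S)"
    by (subst sum.swap) simp
  also have "(\<Sum>x\<in>S. \<Sum>k<d. B $$ (i, k) * M x $$ (k, j)) = (\<Sum>x\<in>S. (B * M x) $$ (i, j))"
  proof (rule sum.cong)
    fix x assume "x \<in> S"
    from M[OF this] show "(\<Sum>k<d. B $$ (i, k) * M x $$ (k, j)) = (B * M x) $$ (i, j)"
      using ij B by (simp only: index_mult_mat_sum[of _ d d _ d])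
  qed simp
  finally show "(B * mat_avg d S M) $$ (i, j) = mat_avg d S (\<lambda>x. B * M x) $$ (i, j)"
    using ij by (simp add: mat_avg_def)
qed (use B in \<open>auto simp: mat_avg_def\<close>)

lemma mat_trace_avg:
  assumes "\<And>x. x \<in> S \<Longrightarrow> M x \<in> carrier_mat d d"
  shows "mat_trace (mat_avg d S M) = (\<Sum>x\<in>S. mat_trace (M x)) / of_nat (card S)"
proof -
  have "mat_trace (mat_avg d S M) = (\<Sum>i<d. \<Sum>x\<in>S. M x $$ (i, i)) / of_nat (card S)"
    by (simp add: mat_trace_def mat_avg_def sum_divide_distrib)
  also have "\<dots> = (\<Sum>x\<in>S. \<Sum>i<d. M x $$ (i, i)) / of_nat (card S)"
    by (subst sum.swap) simp
  also have "(\<Sum>x\<in>S. \<Sum>i<d. M x $$ (i, i)) = (\<Sum>x\<in>S. mat_trace (M x))"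
  proof (rule sum.cong)
    fix x assume "x \<in> S"
    from assms[OF this] show "(\<Sum>i<d. M x $$ (i, i)) = mat_trace (M x)"
      by (simp add: mat_trace_def)
  qed simp
  finally show ?thesis .
qed


section \<open>Matrix representations\<close>

lemma eq_mat_by_vec:
  fixes A B :: "complex mat"
  assumes A: "A \<in> carrier_mat d d" and B: "B \<in> carrier_mat d d"
    and eq: "\<And>v. v \<in> carrier_vec d \<Longrightarrow> A *\<^sub>v v = B *\<^sub>v v"
  shows "A = B"
proof (rule eq_matI)
  fix i j assume "i < dim_row B" "j < dim_col B"
  with B have ij: "i < d" "j < d" by auto
  have "(A *\<^sub>v unit_vec d j) $ i = (B *\<^sub>v unit_vec d j) $ i" by (simp add: eq)
  with A B ij show "A $$ (i, j) = B $$ (i, j)" by simp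
qed (use A B in auto)

locale matrix_rep = group G for G (structure) +
  fixes d :: nat and \<rho> :: "'a \<Rightarrow> complex mat"
  assumes hom: "\<rho> \<in> hom G (GL d)"
begin

lemma rep_carrier: "g \<in> carrier G \<Longrightarrow> \<rho> g \<in> carrier_mat d d"
  using hom by (auto simp: hom_def units_of_def Units_def ring_mat_simps)

lemma rep_mult: "g \<in> carrier G \<Longrightarrow> h \<in> carrier G \<Longrightarrow> \<rho> (g \<otimes> h) = \<rho> g * \<rho> h"
  using hom by (auto simp: hom_def units_of_def ring_mat_simps)

lemma rep_one: "\<rho> \<one> = 1\<^sub>m d"
proof -
  interpret M: ring "ring_mat TYPE(complex) d ()" by (rule ring_mat)
  have "\<rho> \<one> = \<one>\<^bsub>GL d\<^esub>"
    using hom_one[OF hom is_group M.units_group] .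
  then show ?thesis by (simp add: units_of_one ring_mat_simps)
qed

lemma rep_avg_absorb:
  assumes H: "subgroup H G" and h: "h \<in> H"
  shows "\<rho> h * mat_avg d H \<rho> = mat_avg d H \<rho>"
proof -
  interpret H: subgroup H G by (rule H)
  have "\<rho> h * mat_avg d H \<rho> = mat_avg d H (\<lambda>x. \<rho> h * \<rho> x)"
    using h by (intro mat_avg_mult_left rep_carrier) auto
  also have "\<dots> = mat_avg d H (\<lambda>x. \<rho> (h \<otimes> x))"
    using h by (intro mat_avg_cong) (simp add: rep_mult)
  also have "\<dots> = mat_avg d H \<rho>"
  proof (rule mat_avg_reindex)
    show "bij_betw ((\<otimes>) h) H H"
      using h by (intro bij_betwI[where g = "(\<otimes>) (inv h)"]) (auto simp: m_assoc[symmetric])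
  qed
  finally show ?thesis .
qed

lemma rep_avg_idempotent:
  assumes H: "subgroup H G" "finite H"
  shows "mat_avg d H \<rho> * mat_avg d H \<rho> = mat_avg d H \<rho>"
proof -
  interpret H: subgroup H G by (rule H)
  have "mat_avg d H \<rho> * mat_avg d H \<rho> = mat_avg d H (\<lambda>x. \<rho> x * mat_avg d H \<rho>)"
    by (intro mat_avg_mult_right rep_carrier) auto
  also have "\<dots> = mat_avg d H (\<lambda>_. mat_avg d H \<rho>)"
    using H by (intro mat_avg_cong rep_avg_absorb)
  also have "\<dots> = mat_avg d H \<rho>"
    using H(2) H.one_closed by (intro mat_avg_const mat_avg_carrier) blast+
  finally show ?thesis .
qed

text \<open>The average of \<open>\<rho>\<close> over \<open>H\<close> projects onto the \<open>H\<close>-fixed vectors, and \<open>k\<close> is the dimension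
  of the space of these vectors.\<close>

lemma sum_trace_subgroup:
  assumes H: "subgroup H G" "finite H"
  obtains k where "(\<Sum>h\<in>H. mat_trace (\<rho> h)) = of_nat (card H * k)"
proof -
  interpret H: subgroup H G by (rule H)
  obtain k where "mat_trace (mat_avg d H \<rho>) = of_nat k"
    using idempotent_mat_trace[OF mat_avg_carrier rep_avg_idempotent[OF H]] by metis
  moreover have "mat_trace (mat_avg d H \<rho>) = (\<Sum>h\<in>H. mat_trace (\<rho> h)) / of_nat (card H)"
    by (intro mat_trace_avg rep_carrier) auto
  moreover have "card H \<noteq> 0" using H(2) H.one_closed by (metis card_0_eq empty_iff)
  ultimately have "(\<Sum>h\<in>H. mat_trace (\<rho> h)) = of_nat (card H * k)"
    by (simp add: field_simps)
  then show ?thesis by (rule that)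
qed

text \<open>The average over \<open>H\<close> is a projection with full trace, hence the identity matrix, and it absorbs
  every \<open>\<rho> h\<close>.\<close>

lemma trivial_on_subgroup_if_trace_maximal:
  assumes H: "subgroup H G" "finite H" and tr: "\<And>h. h \<in> H \<Longrightarrow> mat_trace (\<rho> h) = of_nat d"
    and h: "h \<in> H"
  shows "\<rho> h = 1\<^sub>m d"
proof -
  interpret H: subgroup H G by (rule H)
  have "card H \<noteq> 0" using H(2) H.one_closed by (metis card_0_eq empty_iff)
  moreover have "mat_trace (mat_avg d H \<rho>) = (\<Sum>h\<in>H. mat_trace (\<rho> h)) / of_nat (card H)"
    by (intro mat_trace_avg rep_carrier) auto
  ultimately have "mat_trace (mat_avg d H \<rho>) = of_nat d" using tr by simp
  then have "mat_avg d H \<rho> = 1\<^sub>m d"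
    by (intro idempotent_mat_full_trace_eq_1 mat_avg_carrier rep_avg_idempotent[OF H])
  with rep_avg_absorb[OF H(1) h] rep_carrier[of h] h show ?thesis by simp
qed

lemma fixed_space_subspace:
  assumes N: "N \<subseteq> carrier G"
  shows "VectorSpace.subspace class_ring {v \<in> carrier_vec d. \<forall>x\<in>N. \<rho> x *\<^sub>v v = v}
    (module_vec TYPE(complex) d)"
proof -
  have "\<rho> x *\<^sub>v 0\<^sub>v d = 0\<^sub>v d" if "x \<in> N" for x
  proof -
    have "\<rho> x \<in> carrier_mat d d" using that N by (auto intro: rep_carrier)
    then show ?thesis by (intro eq_vecI) auto
  qed
  moreover have "\<rho> x *\<^sub>v (v + w) = \<rho> x *\<^sub>v v + \<rho> x *\<^sub>v w"
    if "x \<in> N" "v \<in> carrier_vec d" "w \<in> carrier_vec d" for x v w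
    using rep_carrier[of x] that N by (intro mult_add_distrib_mat_vec) auto
  moreover have "\<rho> x *\<^sub>v (c \<cdot>\<^sub>v v) = c \<cdot>\<^sub>v (\<rho> x *\<^sub>v v)"
    if "x \<in> N" "v \<in> carrier_vec d" for x v c
    using rep_carrier[of x] that N by (intro mult_mat_vec) auto
  ultimately show ?thesis
    by (auto intro!: subspace.intro submodule.intro vec_vs vec_module simp: module_vec_simps)
qed

end


section \<open>Irreducible representations and normal subgroups\<close>

locale irreducible_matrix_rep = group G for G (structure) +
  fixes d :: nat and \<rho> :: "'a \<Rightarrow> complex mat"
  assumes irr: "irreducible_rep G d \<rho>"

sublocale irreducible_matrix_rep \<subseteq> matrix_rep
  using irr by unfold_locales (simp add: irreducible_rep_def)

context irreducible_matrix_rep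
begin

text \<open>Normality makes the space of \<open>N\<close>-fixed vectors invariant under \<open>G\<close>, so it is zero or
  everything. If the sum of the character over some coset of \<open>N\<close> is nonzero, then the projection
  onto this space is nonzero.\<close>

lemma normal_subgroup_acts_trivially:
  assumes N: "N \<lhd> G" "finite N" and g: "g \<in> carrier G"
    and nz: "(\<Sum>x\<in>N. mat_trace (\<rho> (x \<otimes> g))) \<noteq> 0"
    and x: "x \<in> N"
  shows "\<rho> x = 1\<^sub>m d"
proof -
  interpret N: normal N G by (rule N)
  let ?E = "mat_avg d N \<rho>"
  define W where "W = {v \<in> carrier_vec d. \<forall>x\<in>N. \<rho> x *\<^sub>v v = v}"
  have inv: "\<rho> h *\<^sub>v v \<in> W" if h: "h \<in> carrier G" and v: "v \<in> W" for h v
  proof -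
    have vc: "v \<in> carrier_vec d" using v by (simp add: W_def)
    have "\<rho> y *\<^sub>v (\<rho> h *\<^sub>v v) = \<rho> h *\<^sub>v v" if y: "y \<in> N" for y
    proof -
      let ?y = "inv h \<otimes> y \<otimes> h"
      have yN: "?y \<in> N" using N.inv_op_closed1[OF h y] .
      have yc: "y \<in> carrier G" "?y \<in> carrier G" using y yN by auto
      have "\<rho> y *\<^sub>v (\<rho> h *\<^sub>v v) = \<rho> (y \<otimes> h) *\<^sub>v v"
        using h yc vc rep_carrier by (simp add: rep_mult assoc_mult_mat_vec[of _ d d _ d])
      also have "y \<otimes> h = h \<otimes> ?y" using h yc by (simp add: m_assoc[symmetric])
      also have "\<rho> (h \<otimes> ?y) *\<^sub>v v = \<rho> h *\<^sub>v (\<rho> ?y *\<^sub>v v)"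
        using h yc vc rep_carrier rep_mult[OF h yc(2)] by (simp add: assoc_mult_mat_vec[of _ d d _ d])
      also have "\<rho> ?y *\<^sub>v v = v" using v yN by (simp add: W_def)
      finally show ?thesis .
    qed
    then show ?thesis using rep_carrier[OF h] vc by (auto simp: W_def)
  qed
  have "VectorSpace.subspace class_ring W (module_vec TYPE(complex) d)"
    unfolding W_def by (rule fixed_space_subspace) (rule N.subset)
  with inv irr have "W = {0\<^sub>v d} \<or> W = carrier_vec d"
    by (simp add: irreducible_rep_def)
  then show ?thesis
  proof
    assume W: "W = {0\<^sub>v d}"
    have "?E *\<^sub>v v = 0\<^sub>v d" if v: "v \<in> carrier_vec d" for v
    proof -
      have "\<rho> y *\<^sub>v (?E *\<^sub>v v) = ?E *\<^sub>v v" if y: "y \<in> N" for y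
      proof -
        have "\<rho> y *\<^sub>v (?E *\<^sub>v v) = (\<rho> y * ?E) *\<^sub>v v"
          using y v rep_carrier by (intro assoc_mult_mat_vec[symmetric, of _ d d _ d]) auto
        then show ?thesis using rep_avg_absorb[OF N.is_subgroup y] by simp
      qed
      moreover have "?E *\<^sub>v v \<in> carrier_vec d"
        using v mat_avg_carrier by (intro mult_mat_vec_carrier)
      ultimately have "?E *\<^sub>v v \<in> W" by (simp add: W_def)
      then show ?thesis by (simp add: W)
    qed
    then have "?E = 0\<^sub>m d d"
      by (intro eq_mat_by_vec[of _ d]) (auto simp: mat_avg_carrier)
    then have "mat_trace (?E * \<rho> g) = 0"
      using rep_carrier[OF g] by (simp add: mat_trace_def)
    moreover have "?E * \<rho> g = mat_avg d N (\<lambda>x. \<rho> (x \<otimes> g))"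
    proof -
      have "?E * \<rho> g = mat_avg d N (\<lambda>x. \<rho> x * \<rho> g)"
        using g by (intro mat_avg_mult_right rep_carrier) auto
      also have "\<dots> = mat_avg d N (\<lambda>x. \<rho> (x \<otimes> g))"
        using g by (intro mat_avg_cong) (simp add: rep_mult)
      finally show ?thesis .
    qed
    moreover have "mat_trace (mat_avg d N (\<lambda>x. \<rho> (x \<otimes> g))) =
        (\<Sum>x\<in>N. mat_trace (\<rho> (x \<otimes> g))) / of_nat (card N)"
      using g by (intro mat_trace_avg rep_carrier) auto
    moreover have "card N \<noteq> 0" using N(2) N.one_closed by (metis card_0_eq empty_iff)
    ultimately show ?thesis using nz by simp
  next
    assume "W = carrier_vec d"
    with x have fixed: "\<rho> x *\<^sub>v v = v" if "v \<in> carrier_vec d" for v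
      using that by (auto simp: W_def)
    show ?thesis
      using rep_carrier[of x] x fixed by (intro eq_mat_by_vec[of _ d]) auto
  qed
qed

text \<open>If the group acts trivially, every subspace is invariant. In dimension at least 2 the
  hyperplane of vectors with first coordinate 0 is neither zero nor everything.\<close>

lemma dim_eq_1_if_acts_trivially:
  assumes triv: "\<And>g. g \<in> carrier G \<Longrightarrow> \<rho> g = 1\<^sub>m d"
  shows "d = 1"
proof (rule ccontr)
  assume "d \<noteq> 1"
  with irr have d: "d \<ge> 2" by (auto simp: irreducible_rep_def)
  define W where "W = {v \<in> carrier_vec d. v $ 0 = (0::complex)}"
  have "VectorSpace.subspace class_ring W (module_vec TYPE(complex) d)"
    using d by (auto intro!: subspace.intro submodule.intro vec_vs vec_module
        simp: W_def module_vec_simps)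
  moreover have "\<forall>g\<in>carrier G. \<forall>w\<in>W. \<rho> g *\<^sub>v w \<in> W"
    using triv by (auto simp: W_def)
  ultimately have "W = {0\<^sub>v d} \<or> W = carrier_vec d"
    using irr by (auto simp: irreducible_rep_def)
  moreover have "unit_vec d 1 \<in> W" using d by (simp add: W_def)
  moreover have "unit_vec d 1 \<noteq> (0\<^sub>v d :: complex vec)" 
  proof
    assume "unit_vec d 1 = (0\<^sub>v d :: complex vec)"
    then have "unit_vec d 1 $ 1 = (0\<^sub>v d :: complex vec) $ 1" by simp
    with d show False by simp
  qed
  moreover have "unit_vec d 0 \<notin> W" using d by (simp add: W_def)
  moreover have "unit_vec d 0 \<in> carrier_vec d" by simp
  ultimately show False by blast
qed

end


section \<open>Elements of order divisible by a prime\<close>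

lemma (in group) ord_dvd_card_subgroup:
  assumes H: "subgroup H G" and x: "x \<in> H"
  shows "ord x dvd card H"
proof -
  interpret H: group "G\<lparr>carrier := H\<rparr>" by (rule subgroup.subgroup_is_group[OF H is_group])
  have "x [^]\<^bsub>G\<lparr>carrier := H\<rparr>\<^esub> Coset.order (G\<lparr>carrier := H\<rparr>) = \<one>\<^bsub>G\<lparr>carrier := H\<rparr>\<^esub>"
    using x by (intro H.pow_order_eq_1) simp
  then have "x [^] card H = \<one>"
    by (simp add: Coset.order_def nat_pow_consistent[symmetric])
  then show ?thesis using pow_eq_id subgroup.mem_carrier[OF H x] by simp
qed

lemma (in group) exists_element_of_prime_order:
  assumes "finite (carrier G)" "Factorial_Ring.prime p" "p dvd Coset.order G"
  obtains x where "x \<in> carrier G" "ord x = p"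
proof -
  from assms(3) obtain m where "Coset.order G = p ^ 1 * m" by (auto elim: dvdE)
  from sylow_thm[OF assms(2) is_group this assms(1)]
  obtain H where H: "subgroup H G" "card H = p" by auto
  have "H \<noteq> {\<one>}" using H(2) assms(2) by auto
  with H(1) obtain x where x: "x \<in> H" "x \<noteq> \<one>" using subgroup.one_closed[OF H(1)] by blast
  have xc: "x \<in> carrier G" using subgroup.mem_carrier[OF H(1) x(1)] .
  have "ord x dvd p" using ord_dvd_card_subgroup[OF H(1) x(1)] H(2) by simp
  moreover have "ord x \<noteq> 1" using x(2) xc ord_eq_1 by auto
  ultimately have "ord x = p" using assms(2) by (auto simp: prime_nat_iff)
  with xc show ?thesis by (rule that)
qed

lemma (in group) involution_in_2_singular:
  assumes "x \<in> carrier G" "x \<otimes> x = \<one>" "x \<noteq> \<one>"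
  shows "x \<in> p_singular 2 G"
proof -
  have "x [^] (2::nat) = \<one>" using assms by (simp add: numeral_2_eq_2)
  then have "ord x dvd 2" using pow_eq_id assms(1) by blast
  moreover have "ord x \<noteq> 1" using assms ord_eq_1 by auto
  ultimately have "ord x = 2" using two_is_prime_nat by (auto simp: prime_nat_iff)
  then show ?thesis using assms by (simp add: p_singular_def)
qed

text \<open>On a Sylow \<open>p\<close>-subgroup every element other than the identity is \<open>p\<close>-singular, so the
  character sum over it is the degree.\<close>

lemma (in matrix_rep) defect_zero_if_vanishes_on_p_singular:
  assumes fin: "finite (carrier G)" and p: "Factorial_Ring.prime p"
    and van: "\<And>g. g \<in> p_singular p G \<Longrightarrow> mat_trace (\<rho> g) = 0"
  shows "defect_zero p G (\<lambda>g\<in>carrier G. mat_trace (\<rho> g))"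
proof -
  define a where "a = multiplicity p (Coset.order G)"
  have "p ^ a dvd Coset.order G" unfolding a_def by (rule multiplicity_dvd)
  then obtain m where "Coset.order G = p ^ a * m" by (auto elim: dvdE)
  from sylow_thm[OF p is_group this fin]
  obtain P where P: "subgroup P G" "card P = p ^ a" by auto
  interpret P: subgroup P G by (rule P)
  have fP: "finite P" using P.subset fin finite_subset by blast
  have "mat_trace (\<rho> x) = 0" if x: "x \<in> P" "x \<noteq> \<one>" for x
  proof (rule van)
    have "ord x dvd p ^ a" using ord_dvd_card_subgroup[OF P(1) x(1)] P(2) by simp
    then obtain b where "ord x = p ^ b" using p divides_primepow_nat by blast
    moreover have "ord x \<noteq> 1" using x ord_eq_1[of x] by auto
    ultimately have "p dvd ord x" by (cases b) auto
    then show "x \<in> p_singular p G" using x by (simp add: p_singular_def)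
  qed
  then have "(\<Sum>x\<in>P. mat_trace (\<rho> x)) = (\<Sum>x\<in>{\<one>}. mat_trace (\<rho> x))"
    using fP P.one_closed by (intro sum.mono_neutral_right) auto
  then have "(\<Sum>x\<in>P. mat_trace (\<rho> x)) = mat_trace (\<rho> \<one>)" by simp
  moreover obtain k where "(\<Sum>x\<in>P. mat_trace (\<rho> x)) = of_nat (card P * k)"
    using sum_trace_subgroup[OF P(1) fP] .
  ultimately have "mat_trace (\<rho> \<one>) = of_nat (card P * k)" by simp
  moreover have "sylow_subgroup p G P" using P by (simp add: sylow_subgroup_def a_def)
  ultimately show ?thesis unfolding defect_zero_def by auto
qed


section \<open>Transport along homomorphisms\<close>

lemma ord_iso:
  assumes "group H" "group G" "\<phi> \<in> iso H G" "x \<in> carrier H"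
  shows "group.ord G (\<phi> x) = group.ord H x"
proof -
  interpret H: group H by fact
  interpret G: group G by fact
  interpret group_hom H G \<phi>
    using assms by unfold_locales (simp add: iso_def)
  have inj: "inj_on \<phi> (carrier H)" using assms by (simp add: iso_def bij_betw_def)
  have "\<phi> x [^]\<^bsub>G\<^esub> k = \<one>\<^bsub>G\<^esub> \<longleftrightarrow> x [^]\<^bsub>H\<^esub> k = \<one>\<^bsub>H\<^esub>" for k :: nat
  proof -
    have "\<phi> x [^]\<^bsub>G\<^esub> k = \<one>\<^bsub>G\<^esub> \<longleftrightarrow> \<phi> (x [^]\<^bsub>H\<^esub> k) = \<phi> \<one>\<^bsub>H\<^esub>"
      using assms(4) by (simp add: hom_nat_pow)
    also have "\<dots> \<longleftrightarrow> x [^]\<^bsub>H\<^esub> k = \<one>\<^bsub>H\<^esub>"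
      using inj assms(4) by (intro inj_on_eq_iff) auto
    finally show ?thesis .
  qed
  then have "G.ord (\<phi> x) dvd k \<longleftrightarrow> H.ord x dvd k" for k
    using assms(4) by (simp add: G.pow_eq_id[symmetric] H.pow_eq_id[symmetric])
  then show ?thesis by (meson dvd_antisym dvd_refl)
qed

lemma p_singular_iso:
  assumes "group H" "group G" "\<phi> \<in> iso H G"
  shows "p_singular p G = \<phi> ` p_singular p H"
proof -
  have "carrier G = \<phi> ` carrier H" using assms by (simp add: iso_def bij_betw_def)
  then show ?thesis using ord_iso[OF assms] by (auto simp: p_singular_def)
qed

text \<open>Irreducibility depends only on the set of matrices of the representation. This serves twice: to
  pull \<open>\<chi>\<close> back to the wreath product, and to push it down to the symmetric group.\<close>

lemma irreducible_rep_surj: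
  assumes \<pi>: "\<pi> \<in> hom H G" "\<pi> ` carrier H = carrier G" and \<rho>: "\<rho> \<in> hom G (GL d)"
    and eq: "\<And>x. x \<in> carrier H \<Longrightarrow> \<rho>' x = \<rho> (\<pi> x)"
    and H: "group H"
  shows "irreducible_rep H d \<rho>' \<longleftrightarrow> irreducible_rep G d \<rho>"
proof -
  interpret H: group H by (rule H)
  have "\<rho>' \<in> hom H (GL d)"
    using \<pi>(1) \<rho> eq by (auto simp: hom_def Pi_iff)
  moreover have "(\<forall>g\<in>carrier H. \<forall>w\<in>W. \<rho>' g *\<^sub>v w \<in> W) \<longleftrightarrow>
      (\<forall>g\<in>carrier G. \<forall>w\<in>W. \<rho> g *\<^sub>v w \<in> W)" for W
    using eq by (auto simp: \<pi>(2)[symmetric])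
  ultimately show ?thesis using \<rho> by (simp add: irreducible_rep_def)
qed


section \<open>The wreath product\<close>

lemma carrier_C2_power: "carrier (C2_power n) = {1..n} \<rightarrow>\<^sub>E {0..<2}"
  by (simp add: C2_power_def integer_mod_group_def)

lemma one_C2_power: "\<one>\<^bsub>C2_power n\<^esub> = (\<lambda>i\<in>{1..n}. 0)"
  by (simp add: C2_power_def)

lemma carrier_wreath:
  "x \<in> carrier (wreath_C2_Sym n) \<longleftrightarrow> fst x \<in> carrier (C2_power n) \<and> snd x \<in> carrier (sym_group n)"
  by (cases x) (simp add: wreath_C2_Sym_def)

lemma snd_mult_wreath:
  "snd (x \<otimes>\<^bsub>wreath_C2_Sym n\<^esub> y) = snd x \<otimes>\<^bsub>sym_group n\<^esub> snd y"
  by (cases x; cases y) (simp add: wreath_C2_Sym_def)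

lemma snd_group_hom: "group_hom (wreath_C2_Sym n) (sym_group n) snd"
  using group_wreath_C2_Sym[of n] sym_group_is_group[of n]
  by (auto simp: group_hom_def group_hom_axioms_def hom_def carrier_wreath snd_mult_wreath)

lemma finite_carrier_sym_group: "finite (carrier (sym_group n))"
  by (simp add: sym_group_def finite_permutations)

lemma finite_carrier_wreath: "finite (carrier (wreath_C2_Sym n))"
  by (simp add: wreath_C2_Sym_def finite_carrier_sym_group carrier_C2_power finite_PiE)

lemma base_subgroup_eq_kernel:
  "base_subgroup n = kernel (wreath_C2_Sym n) (sym_group n) snd"
proof -
  interpret S: group "sym_group n" by (rule sym_group_is_group)
  show ?thesis using S.one_closed
    by (auto simp: base_subgroup_def kernel_def carrier_wreath)
qed

lemma base_subgroup_normal: "base_subgroup n \<lhd> wreath_C2_Sym n"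
  unfolding base_subgroup_eq_kernel by (rule group_hom.normal_kernel[OF snd_group_hom])

lemma finite_base_subgroup: "finite (base_subgroup n)"
  unfolding base_subgroup_eq_kernel kernel_def using finite_carrier_wreath by simp

lemma base_square:
  assumes "x \<in> base_subgroup n"
  shows "x \<otimes>\<^bsub>wreath_C2_Sym n\<^esub> x = \<one>\<^bsub>wreath_C2_Sym n\<^esub>"
proof -
  obtain f where x: "x = (f, id)" and f: "f \<in> {1..n} \<rightarrow>\<^sub>E {0..<2}"
    using assms by (auto simp: base_subgroup_def sym_group_one carrier_C2_power)
  have "(f i + f i) mod 2 = 0" for i by presburger
  then show ?thesis
    using f by (auto simp: x wreath_C2_Sym_def sym_group_one sym_group_mult permute_factors_def
        C2_power_def PiE_iff extensional_def restrict_def integer_mod_group_def)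
qed

lemma complement_hom:
  "(\<lambda>\<sigma>. (\<one>\<^bsub>C2_power n\<^esub>, \<sigma>)) \<in> hom (sym_group n) (wreath_C2_Sym n)"
proof -
  interpret C: group "C2_power n" by (rule group_C2_power)
  have "permute_factors n \<sigma> \<one>\<^bsub>C2_power n\<^esub> = \<one>\<^bsub>C2_power n\<^esub>" if "\<sigma> \<in> carrier (sym_group n)" for \<sigma>
  proof -
    have "inv_into UNIV \<sigma> i \<in> {1..n}" if "i \<in> {1..n}" for i
      using \<open>\<sigma> \<in> carrier (sym_group n)\<close> that
      by (metis permutes_in_image permutes_inv sym_group_carrier)
    then show ?thesis by (auto simp: permute_factors_def one_C2_power)
  qed
  then show ?thesis by (auto simp: hom_def wreath_C2_Sym_def)
qed

lemma wreath_decompose: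
  assumes "x \<in> carrier (wreath_C2_Sym n)"
  shows "x = (fst x, \<one>\<^bsub>sym_group n\<^esub>) \<otimes>\<^bsub>wreath_C2_Sym n\<^esub> (\<one>\<^bsub>C2_power n\<^esub>, snd x)"
proof -
  interpret C: group "C2_power n" by (rule group_C2_power)
  interpret S: group "sym_group n" by (rule sym_group_is_group)
  have "permute_factors n \<one>\<^bsub>sym_group n\<^esub> \<one>\<^bsub>C2_power n\<^esub> = \<one>\<^bsub>C2_power n\<^esub>"
    by (auto simp: permute_factors_def one_C2_power sym_group_one)
  then show ?thesis using assms
    by (cases x) (simp add: wreath_C2_Sym_def)
qed

lemma ord_snd_dvd:
  assumes x: "x \<in> carrier (wreath_C2_Sym n)"
  shows "group.ord (sym_group n) (snd x) dvd group.ord (wreath_C2_Sym n) x"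
proof -
  interpret snd: group_hom "wreath_C2_Sym n" "sym_group n" snd by (rule snd_group_hom)
  have "snd (x [^]\<^bsub>wreath_C2_Sym n\<^esub> snd.G.ord x) = \<one>\<^bsub>sym_group n\<^esub>"
    using x by simp
  then have "snd x [^]\<^bsub>sym_group n\<^esub> snd.G.ord x = \<one>\<^bsub>sym_group n\<^esub>"
    using snd.hom_nat_pow[OF x] by simp
  then show ?thesis
    using snd.H.pow_eq_id[OF snd.hom_closed[OF x]] by blast
qed

text \<open>If \<open>k\<close> is the order of the permutation, the \<open>k\<close>-th power lies in the base group, which has
  exponent at most 2.\<close>

lemma ord_dvd_twice_ord_snd:
  assumes x: "x \<in> carrier (wreath_C2_Sym n)"
  shows "group.ord (wreath_C2_Sym n) x dvd group.ord (sym_group n) (snd x) * 2"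
proof -
  interpret snd: group_hom "wreath_C2_Sym n" "sym_group n" snd by (rule snd_group_hom)
  define y where "y = x [^]\<^bsub>wreath_C2_Sym n\<^esub> snd.H.ord (snd x)"
  have "y \<in> base_subgroup n"
    using x by (simp add: base_subgroup_eq_kernel kernel_def y_def snd.hom_nat_pow)
  moreover have "y \<in> carrier (wreath_C2_Sym n)" using x by (simp add: y_def)
  ultimately have "y [^]\<^bsub>wreath_C2_Sym n\<^esub> (2::nat) = \<one>\<^bsub>wreath_C2_Sym n\<^esub>"
    using base_square by (simp add: numeral_2_eq_2)
  then show ?thesis
    using x by (simp add: y_def snd.G.nat_pow_pow snd.G.pow_eq_id)
qed

lemma p_singular_wreath_if_snd:
  assumes "x \<in> carrier (wreath_C2_Sym n)" "p dvd group.ord (sym_group n) (snd x)"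
  shows "x \<in> p_singular p (wreath_C2_Sym n)"
  using assms ord_snd_dvd[OF assms(1)] by (auto simp: p_singular_def intro: dvd_trans)

lemma p_singular_snd_if_wreath:
  assumes x: "x \<in> p_singular p (wreath_C2_Sym n)" and p: "Factorial_Ring.prime p" "p > 2"
  shows "snd x \<in> p_singular p (sym_group n)"
proof -
  from x have xc: "x \<in> carrier (wreath_C2_Sym n)"
    and "p dvd group.ord (sym_group n) (snd x) * 2"
    using ord_dvd_twice_ord_snd[of x n] by (auto simp: p_singular_def intro: dvd_trans)
  moreover have "\<not> p dvd 2" using p(2) by (auto dest: dvd_imp_le)
  ultimately show ?thesis
    using p(1) by (auto simp: p_singular_def carrier_wreath prime_dvd_mult_iff)
qed


section \<open>Characters constant on the p-singular elements of the wreath product\<close>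

text \<open>The elements above a permutation of order \<open>p\<close> form a coset of the base group and are all
  \<open>p\<close>-singular, so the character sum over this coset is a nonzero multiple of \<open>c\<close>.\<close>

lemma base_acts_trivially_if_p_constant:
  assumes irr: "irreducible_rep (wreath_C2_Sym n) d \<rho>"
    and p: "Factorial_Ring.prime p" "p \<le> n" and c: "c \<noteq> 0"
    and const: "\<And>x. x \<in> p_singular p (wreath_C2_Sym n) \<Longrightarrow> mat_trace (\<rho> x) = c"
    and x: "x \<in> base_subgroup n"
  shows "\<rho> x = 1\<^sub>m d"
proof -
  interpret W: group "wreath_C2_Sym n" by (rule group_wreath_C2_Sym)
  interpret C: group "C2_power n" by (rule group_C2_power)
  interpret S: group "sym_group n" by (rule sym_group_is_group)
  interpret irreducible_matrix_rep "wreath_C2_Sym n" d \<rho>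
    using irr by unfold_locales
  interpret N: normal "base_subgroup n" "wreath_C2_Sym n" by (rule base_subgroup_normal)
  have "Coset.order (sym_group n) = fact n"
    by (simp add: Coset.order_def sym_group_def card_permutations)
  with p have "p dvd Coset.order (sym_group n)" by (simp add: prime_dvd_fact_iff)
  from S.exists_element_of_prime_order[OF finite_carrier_sym_group p(1) this]
  obtain \<sigma> where \<sigma>: "\<sigma> \<in> carrier (sym_group n)" "S.ord \<sigma> = p" .
  let ?g = "(\<one>\<^bsub>C2_power n\<^esub>, \<sigma>)"
  have g: "?g \<in> carrier (wreath_C2_Sym n)" using \<sigma> by (simp add: carrier_wreath)
  have "mat_trace (\<rho> (y \<otimes>\<^bsub>wreath_C2_Sym n\<^esub> ?g)) = c" if y: "y \<in> base_subgroup n" for y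
  proof (intro const p_singular_wreath_if_snd)
    show "y \<otimes>\<^bsub>wreath_C2_Sym n\<^esub> ?g \<in> carrier (wreath_C2_Sym n)"
      using y g by (intro W.m_closed) auto
    have "snd y = \<one>\<^bsub>sym_group n\<^esub>" using y by (auto simp: base_subgroup_def)
    then show "p dvd S.ord (snd (y \<otimes>\<^bsub>wreath_C2_Sym n\<^esub> ?g))"
      using \<sigma> by (simp add: snd_mult_wreath)
  qed
  then have "(\<Sum>y\<in>base_subgroup n. mat_trace (\<rho> (y \<otimes>\<^bsub>wreath_C2_Sym n\<^esub> ?g))) =
      of_nat (card (base_subgroup n)) * c"
    by simp
  moreover have "card (base_subgroup n) \<noteq> 0"
    using finite_base_subgroup[of n] N.one_closed by (metis card_0_eq empty_iff)
  ultimately have "(\<Sum>y\<in>base_subgroup n. mat_trace (\<rho> (y \<otimes>\<^bsub>wreath_C2_Sym n\<^esub> ?g))) \<noteq> 0"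
    using c by simp
  from normal_subgroup_acts_trivially[OF base_subgroup_normal finite_base_subgroup g this x]
  show ?thesis .
qed

text \<open>The nonidentity elements of the base group are involutions, and they act trivially, so the
  constant is the degree. A transposition is an involution, too; having the degree as its trace it
  acts trivially. The base group and the transpositions generate the wreath product.\<close>

lemma acts_trivially_if_2_constant:
  assumes irr: "irreducible_rep (wreath_C2_Sym n) d \<rho>"
    and n: "n \<ge> 2" and c: "c \<noteq> 0"
    and const: "\<And>x. x \<in> p_singular 2 (wreath_C2_Sym n) \<Longrightarrow> mat_trace (\<rho> x) = c"
    and x: "x \<in> carrier (wreath_C2_Sym n)"
  shows "\<rho> x = 1\<^sub>m d"
proof -
  interpret C: group "C2_power n" by (rule group_C2_power)
  interpret S: group "sym_group n" by (rule sym_group_is_group)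
  interpret irreducible_matrix_rep "wreath_C2_Sym n" d \<rho>
    using irr group_wreath_C2_Sym by (intro irreducible_matrix_rep.intro irreducible_matrix_rep_axioms.intro)
  note base_triv = base_acts_trivially_if_p_constant[OF irr two_is_prime_nat n c const]
  let ?lift = "\<lambda>\<sigma>. (\<one>\<^bsub>C2_power n\<^esub>, \<sigma>)"
  (* The constant c is the degree d, because some nonidentity base element exists. *)
  define f :: "nat \<Rightarrow> int" where "f = (\<lambda>i\<in>{1..n}. 1)"
  have fb: "(f, id) \<in> base_subgroup n"
    by (simp add: base_subgroup_def carrier_C2_power sym_group_one f_def)
  have "f 1 \<noteq> \<one>\<^bsub>C2_power n\<^esub> 1" using n by (simp add: f_def one_C2_power)
  then have "(f, id) \<noteq> \<one>\<^bsub>wreath_C2_Sym n\<^esub>" by (auto simp: wreath_C2_Sym_def)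
  moreover have "(f, id) \<in> carrier (wreath_C2_Sym n)"
    using fb by (simp add: base_subgroup_eq_kernel kernel_def)
  ultimately have "(f, id) \<in> p_singular 2 (wreath_C2_Sym n)"
    using base_square[OF fb] by (intro involution_in_2_singular)
  then have cd: "c = of_nat d"
    using const base_triv[OF _ fb] by (metis mat_trace_one)
  have transp: "\<rho> (?lift (transpose a b)) = 1\<^sub>m d"
    if ab: "a \<in> {1..n}" "b \<in> {1..n}" "a \<noteq> b" for a b
  proof -
    let ?t = "transpose a b" and ?H = "{\<one>\<^bsub>wreath_C2_Sym n\<^esub>, ?lift (transpose a b)}"
    have t: "?t \<in> carrier (sym_group n)"
      using ab by (simp add: sym_group_carrier permutes_swap_id)
    then have lt: "?lift ?t \<in> carrier (wreath_C2_Sym n)" by (simp add: carrier_wreath)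
    have "?lift ?t \<otimes>\<^bsub>wreath_C2_Sym n\<^esub> ?lift ?t = ?lift (?t \<otimes>\<^bsub>sym_group n\<^esub> ?t)"
      using hom_mult[OF complement_hom t t] by simp
    also have "\<dots> = \<one>\<^bsub>wreath_C2_Sym n\<^esub>"
      by (simp add: wreath_C2_Sym_def sym_group_mult sym_group_one)
    finally have tt: "?lift ?t \<otimes>\<^bsub>wreath_C2_Sym n\<^esub> ?lift ?t = \<one>\<^bsub>wreath_C2_Sym n\<^esub>" .
    have "?t a \<noteq> id a" using ab by simp
    then have "?lift ?t \<noteq> \<one>\<^bsub>wreath_C2_Sym n\<^esub>"
      by (auto simp: wreath_C2_Sym_def sym_group_one simp del: transpose_apply_first)
    with lt tt have "?lift ?t \<in> p_singular 2 (wreath_C2_Sym n)"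
      by (intro involution_in_2_singular)
    then have tr: "mat_trace (\<rho> (?lift ?t)) = of_nat d" using const cd by simp
    have inv: "inv\<^bsub>wreath_C2_Sym n\<^esub> ?lift ?t = ?lift ?t"
      using tt lt by (intro inv_equality)
    have "subgroup ?H (wreath_C2_Sym n)"
      by (rule subgroupI) (use lt tt inv in auto)
    moreover have "mat_trace (\<rho> h) = of_nat d" if "h \<in> ?H" for h
      using that tr by (auto simp: rep_one mat_trace_one)
    ultimately show ?thesis
      by (intro trivial_on_subgroup_if_trace_maximal[of ?H]) auto
  qed
  have lift_triv: "\<rho> (?lift \<sigma>) = 1\<^sub>m d" if "\<sigma> permutes {1..n}" for \<sigma>
    using that finite_atLeastAtMost
  proof (induction rule: permutes_induct)
    case id
    have "?lift id = \<one>\<^bsub>wreath_C2_Sym n\<^esub>" by (simp add: wreath_C2_Sym_def sym_group_one)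
    then show ?case by (simp only: rep_one)
  next
    case (swap a b q)
    have t: "transpose a b \<in> carrier (sym_group n)" and q: "q \<in> carrier (sym_group n)"
      using swap by (simp_all add: sym_group_carrier permutes_swap_id)
    have "?lift (transpose a b \<circ> q) = ?lift (transpose a b) \<otimes>\<^bsub>wreath_C2_Sym n\<^esub> ?lift q"
      using hom_mult[OF complement_hom t q] by (simp add: sym_group_mult)
    moreover have "?lift (transpose a b) \<in> carrier (wreath_C2_Sym n)"
      "?lift q \<in> carrier (wreath_C2_Sym n)"
      using t q by (simp_all add: carrier_wreath)
    ultimately have "\<rho> (?lift (transpose a b \<circ> q)) = \<rho> (?lift (transpose a b)) * \<rho> (?lift q)"
      by (simp only: rep_mult)
    then show ?case using transp[OF swap(1-3)] swap by (simp add: comp_def)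
  qed
  have s: "snd x permutes {1..n}" using x by (simp add: carrier_wreath sym_group_carrier)
  have fx: "(fst x, \<one>\<^bsub>sym_group n\<^esub>) \<in> base_subgroup n"
    using x by (simp add: base_subgroup_def carrier_wreath)
  have "\<rho> x = \<rho> (fst x, \<one>\<^bsub>sym_group n\<^esub>) * \<rho> (?lift (snd x))"
    using x wreath_decompose[OF x]
      rep_mult[of "(fst x, \<one>\<^bsub>sym_group n\<^esub>)" "?lift (snd x)"]
    by (simp add: carrier_wreath)
  also have "\<dots> = 1\<^sub>m d"
    using lift_triv[OF s] base_triv[OF _ fx] by simp
  finally show ?thesis .
qed


section \<open>Deflation to the symmetric group\<close>

lemma irreducible_rep_deflate:
  assumes irr: "irreducible_rep (wreath_C2_Sym n) d \<rho>"
    and triv: "\<And>x. x \<in> base_subgroup n \<Longrightarrow> \<rho> x = 1\<^sub>m d"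
  shows "irreducible_rep (sym_group n) d (\<lambda>\<sigma>. \<rho> (\<one>\<^bsub>C2_power n\<^esub>, \<sigma>))"
    and "x \<in> carrier (wreath_C2_Sym n) \<Longrightarrow> \<rho> x = \<rho> (\<one>\<^bsub>C2_power n\<^esub>, snd x)"
proof -
  interpret C: group "C2_power n" by (rule group_C2_power)
  interpret S: group "sym_group n" by (rule sym_group_is_group)
  interpret irreducible_matrix_rep "wreath_C2_Sym n" d \<rho>
    using irr group_wreath_C2_Sym by (intro irreducible_matrix_rep.intro irreducible_matrix_rep_axioms.intro)
  interpret snd: group_hom "wreath_C2_Sym n" "sym_group n" snd by (rule snd_group_hom)
  have factor: "\<rho> x = \<rho> (\<one>\<^bsub>C2_power n\<^esub>, snd x)" if x: "x \<in> carrier (wreath_C2_Sym n)" for x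
  proof -
    have l: "(\<one>\<^bsub>C2_power n\<^esub>, snd x) \<in> carrier (wreath_C2_Sym n)"
      and b: "(fst x, \<one>\<^bsub>sym_group n\<^esub>) \<in> base_subgroup n"
      "(fst x, \<one>\<^bsub>sym_group n\<^esub>) \<in> carrier (wreath_C2_Sym n)"
      using x by (simp_all add: carrier_wreath base_subgroup_def)
    have "\<rho> x = \<rho> (fst x, \<one>\<^bsub>sym_group n\<^esub>) * \<rho> (\<one>\<^bsub>C2_power n\<^esub>, snd x)"
      using wreath_decompose[OF x] rep_mult[OF b(2) l] by simp
    with triv[OF b(1)] rep_carrier[OF l] show ?thesis by simp
  qed
  then show "x \<in> carrier (wreath_C2_Sym n) \<Longrightarrow> \<rho> x = \<rho> (\<one>\<^bsub>C2_power n\<^esub>, snd x)" .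
  have surj: "snd ` carrier (wreath_C2_Sym n) = carrier (sym_group n)"
    by (force simp: wreath_C2_Sym_def)
  have "(\<lambda>\<sigma>. \<rho> (\<one>\<^bsub>C2_power n\<^esub>, \<sigma>)) \<in> hom (sym_group n) (GL d)"
    using Group.hom_compose[OF complement_hom hom] by (simp add: comp_def)
  from irreducible_rep_surj[where \<pi> = snd and \<rho>' = \<rho> and \<rho> = "\<lambda>\<sigma>. \<rho> (\<one>\<^bsub>C2_power n\<^esub>, \<sigma>)",
      OF snd.homh surj this factor is_group] irr
  show "irreducible_rep (sym_group n) d (\<lambda>\<sigma>. \<rho> (\<one>\<^bsub>C2_power n\<^esub>, \<sigma>))" by blast
qed

text \<open>Inflation is injective because elements of \<open>Irr\<close> are extensional, so the definite description
  is determined by any irreducible character that inflates to \<open>\<chi>\<close>.\<close>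

lemma bar_char_eqI:
  assumes \<psi>: "\<psi> \<in> Irr (sym_group n)"
    and infl: "\<And>x. x \<in> carrier (wreath_C2_Sym n) \<Longrightarrow> \<chi> (\<phi> x) = \<psi> (snd x)"
  shows "bar_char n \<phi> \<chi> = \<psi>"
  unfolding bar_char_def
proof (rule the_equality)
  fix \<psi>' assume \<psi>': "\<psi>' \<in> Irr (sym_group n) \<and>
    (\<forall>x\<in>carrier (wreath_C2_Sym n). \<chi> (\<phi> x) = \<psi>' (snd x))"
  interpret C: group "C2_power n" by (rule group_C2_power)
  show "\<psi>' = \<psi>"
  proof
    fix \<sigma>
    show "\<psi>' \<sigma> = \<psi> \<sigma>"
    proof (cases "\<sigma> \<in> carrier (sym_group n)")
      case True
      then have "(\<one>\<^bsub>C2_power n\<^esub>, \<sigma>) \<in> carrier (wreath_C2_Sym n)" by (simp add: carrier_wreath)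
      with infl \<psi>' show ?thesis by (metis snd_conv)
    next
      case False
      with \<psi> \<psi>' show ?thesis by (auto simp: Irr_def)
    qed
  qed
qed (use assms in auto)


section \<open>Characters of non-zero defect\<close>

theorem corollary3p4:
  fixes G :: "('a, 'b) monoid_scheme"
    and \<phi> :: "(nat \<Rightarrow> int) \<times> (nat \<Rightarrow> nat) \<Rightarrow> 'a"
    and \<chi> :: "'a \<Rightarrow> complex"
    and n p :: nat
  assumes "n \<ge> 2"
    and "group G"
    and "\<phi> \<in> iso (wreath_C2_Sym n) G"
    and "Factorial_Ring.prime p" and "p \<le> n"
    and "\<chi> \<in> Irr G"
    and "\<not> defect_zero p G \<chi>"
    and "p = 2 \<Longrightarrow> \<chi> \<noteq> trivial_char G"
  shows "p_constant p G \<chi> \<longleftrightarrow>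
    p > 2 \<and> \<phi> ` base_subgroup n \<subseteq> char_kernel G \<chi> \<and>
    p_constant p (sym_group n) (bar_char n \<phi> \<chi>)"
proof -
  let ?W = "wreath_C2_Sym n"
  interpret W: group ?W by (rule group_wreath_C2_Sym)
  interpret C: group "C2_power n" by (rule group_C2_power)
  interpret S: group "sym_group n" by (rule sym_group_is_group)
  interpret G: group G by fact
  from \<open>\<phi> \<in> iso ?W G\<close> have \<phi>: "\<phi> \<in> hom ?W G" and \<phi>_surj: "\<phi> ` carrier ?W = carrier G"
    by (auto simp: iso_def bij_betw_def)
  from \<open>\<chi> \<in> Irr G\<close> obtain d \<rho>0 where irr0: "irreducible_rep G d \<rho>0"
    and \<chi>: "\<chi> = (\<lambda>g\<in>carrier G. mat_trace (\<rho>0 g))"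
    by (auto simp: Irr_def)
  interpret R0: irreducible_matrix_rep G d \<rho>0 using irr0 by unfold_locales
  define \<rho> where "\<rho> x = \<rho>0 (\<phi> x)" for x
  have irr: "irreducible_rep ?W d \<rho>"
    using irreducible_rep_surj[OF \<phi> \<phi>_surj R0.hom, of \<rho>] irr0 W.is_group
    by (simp add: \<rho>_def)
  interpret R: irreducible_matrix_rep ?W d \<rho> using irr by unfold_locales
  have \<phi>_carrier: "\<phi> x \<in> carrier G" if "x \<in> carrier ?W" for x
    using that \<phi>_surj by auto
  have \<chi>_\<phi>: "\<chi> (\<phi> x) = mat_trace (\<rho> x)" if "x \<in> carrier ?W" for x
    using \<phi>_carrier[OF that] by (simp add: \<chi> \<rho>_def)
  have \<chi>_one: "\<chi> \<one>\<^bsub>G\<^esub> = of_nat d"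
    by (simp add: \<chi> R0.rep_one mat_trace_one)
  have base_carrier: "x \<in> carrier ?W" if "x \<in> base_subgroup n" for x
    using that by (simp add: base_subgroup_eq_kernel kernel_def)
  have sing: "p_singular p G = \<phi> ` p_singular p ?W"
    using p_singular_iso[OF W.is_group G.is_group \<open>\<phi> \<in> iso ?W G\<close>] .
  have finG: "finite (carrier G)"
    using finite_carrier_wreath[of n] by (simp flip: \<phi>_surj)
  have bar: "bar_char n \<phi> \<chi> \<sigma> = mat_trace (\<rho> (\<one>\<^bsub>C2_power n\<^esub>, \<sigma>))"
    if triv: "\<And>x. x \<in> base_subgroup n \<Longrightarrow> \<rho> x = 1\<^sub>m d" and \<sigma>: "\<sigma> \<in> carrier (sym_group n)" for \<sigma>
  proof -
    let ?\<psi> = "\<lambda>\<sigma>\<in>carrier (sym_group n). mat_trace (\<rho> (\<one>\<^bsub>C2_power n\<^esub>, \<sigma>))"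
    note defl = irreducible_rep_deflate[OF irr triv]
    have "?\<psi> \<in> Irr (sym_group n)"
      using defl(1) by (auto simp: Irr_def)
    moreover have "\<chi> (\<phi> x) = ?\<psi> (snd x)" if "x \<in> carrier ?W" for x
      using \<chi>_\<phi>[OF that] defl(2)[OF _ that] that by (simp add: carrier_wreath)
    ultimately have "bar_char n \<phi> \<chi> = ?\<psi>" by (rule bar_char_eqI)
    then show ?thesis using \<sigma> by simp
  qed
  show ?thesis
  proof
    assume "p_constant p G \<chi>"
    then obtain c where c: "\<And>g. g \<in> p_singular p G \<Longrightarrow> \<chi> g = c"
      by (auto simp: p_constant_def)
    have const: "mat_trace (\<rho> x) = c" if "x \<in> p_singular p ?W" for x
      using c[of "\<phi> x"] that \<chi>_\<phi>[of x] sing by (auto simp: p_singular_def)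
    (* This is where the assumption that the defect is not zero enters. *)
    have c0: "c \<noteq> 0"
    proof
      assume "c = 0"
      then have "mat_trace (\<rho>0 g) = 0" if "g \<in> p_singular p G" for g
        using c[OF that] that by (simp add: \<chi> p_singular_def)
      then have "defect_zero p G \<chi>"
        unfolding \<chi> using finG \<open>Factorial_Ring.prime p\<close>
        by (intro R0.defect_zero_if_vanishes_on_p_singular)
      with \<open>\<not> defect_zero p G \<chi>\<close> show False by simp
    qed
    have triv: "\<rho> x = 1\<^sub>m d" if "x \<in> base_subgroup n" for x
      using base_acts_trivially_if_p_constant[OF irr \<open>Factorial_Ring.prime p\<close> \<open>p \<le> n\<close> c0 const that] .
    have "p \<noteq> 2"
    proof
      assume p2: "p = 2"
      have all: "\<rho> x = 1\<^sub>m d" if "x \<in> carrier ?W" for x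
        using acts_trivially_if_2_constant[OF irr \<open>n \<ge> 2\<close> c0 _ that] const p2 by blast
      then have "d = 1" by (rule R.dim_eq_1_if_acts_trivially)
      with all have "\<chi> (\<phi> x) = 1" if "x \<in> carrier ?W" for x
        using \<chi>_\<phi>[OF that] that by (simp add: mat_trace_one)
      then have "\<chi> g = 1" if "g \<in> carrier G" for g
        using that by (auto simp flip: \<phi>_surj)
      then have "\<chi> = trivial_char G" by (auto simp: trivial_char_def \<chi>)
      with p2 \<open>p = 2 \<Longrightarrow> \<chi> \<noteq> trivial_char G\<close> show False by simp
    qed
    with prime_ge_2_nat[OF \<open>Factorial_Ring.prime p\<close>] have "p > 2" by simp
    moreover have "\<phi> ` base_subgroup n \<subseteq> char_kernel G \<chi>"
      using triv base_carrier \<phi>_carrier \<chi>_\<phi> by (auto simp: char_kernel_def \<chi>_one mat_trace_one)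
    moreover have "bar_char n \<phi> \<chi> \<sigma> = c" if \<sigma>: "\<sigma> \<in> p_singular p (sym_group n)" for \<sigma>
    proof -
      have "(\<one>\<^bsub>C2_power n\<^esub>, \<sigma>) \<in> p_singular p ?W"
        using \<sigma> by (intro p_singular_wreath_if_snd) (auto simp: p_singular_def carrier_wreath)
      then show ?thesis using bar[OF triv] const \<sigma> by (simp add: p_singular_def)
    qed
    ultimately show "p > 2 \<and> \<phi> ` base_subgroup n \<subseteq> char_kernel G \<chi> \<and>
      p_constant p (sym_group n) (bar_char n \<phi> \<chi>)"
      by (auto simp: p_constant_def)
  next
    assume asm: "p > 2 \<and> \<phi> ` base_subgroup n \<subseteq> char_kernel G \<chi> \<and>
      p_constant p (sym_group n) (bar_char n \<phi> \<chi>)"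
    then obtain c where c: "\<And>\<sigma>. \<sigma> \<in> p_singular p (sym_group n) \<Longrightarrow> bar_char n \<phi> \<chi> \<sigma> = c"
      by (auto simp: p_constant_def)
    have "mat_trace (\<rho> x) = of_nat d" if "x \<in> base_subgroup n" for x
      using asm that \<chi>_\<phi>[OF base_carrier[OF that]] by (auto simp: char_kernel_def \<chi>_one)
    then have triv: "\<rho> x = 1\<^sub>m d" if "x \<in> base_subgroup n" for x
      using R.trivial_on_subgroup_if_trace_maximal[OF _ finite_base_subgroup _ that]
        normal_imp_subgroup[OF base_subgroup_normal] by blast
    have "\<chi> (\<phi> x) = c" if x: "x \<in> p_singular p ?W" for x
    proof -
      have xc: "x \<in> carrier ?W" using x by (simp add: p_singular_def)
      have s: "snd x \<in> p_singular p (sym_group n)"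
        using p_singular_snd_if_wreath[OF x \<open>Factorial_Ring.prime p\<close>] asm by simp
      have "\<chi> (\<phi> x) = mat_trace (\<rho> (\<one>\<^bsub>C2_power n\<^esub>, snd x))"
        using \<chi>_\<phi>[OF xc] irreducible_rep_deflate(2)[OF irr triv xc] by simp
      also have "\<dots> = c" using bar[OF triv, of "snd x"] c[OF s] s by (simp add: p_singular_def)
      finally show ?thesis .
    qed
    then show "p_constant p G \<chi>" by (auto simp: p_constant_def sing)
  qed
qed

end
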